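(* Let $H$ be a Hopf algebra over a field $\Bbbk$. Let $C_1,\dots,C_k$ be finite-dimensional left coideal subalgebras of $H$ and assume that $C = \sum_{i=1}^k C_i$ is stable under the left adjoint action of $H$. Then $C$ generates a finite-dimensional subalgebra of $H$.
   Context: $\Bbbk$ is an arbitrary field and $\otimes = \otimes_\Bbbk$. $H$ has comultiplication $\Delta h = h_{(1)} \otimes h_{(2)}$ (Sweedler notation) and antipode $\mathsf{S}$. The left adjoint action of $H$ on itself is $k.h = k_{(1)}\, h\, \mathsf{S}(k_{(2)})$ for $h,k \in H$. A left coideal subalgebra of $H$ is a subalgebra $B \subseteq H$ with $\Delta(B) \subseteq H \otimes B$. *)

theory Defs
  imports
    Complex_Main
    "HOL-Library.Poly_Mapping"
    "HOL-Library.Set_Algebras"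
begin

section \<open>Formal linear combinations\<close>

text \<open>
  The type \<^typ>\<open>'x \<Rightarrow>\<^sub>0 'k\<close> is the vector space with basis \<^typ>\<open>'x\<close>.
\<close>

definition fscale :: "'k::field \<Rightarrow> ('x \<Rightarrow>\<^sub>0 'k) \<Rightarrow> 'x \<Rightarrow>\<^sub>0 'k"
  where "fscale c p = Poly_Mapping.map ((*) c) p"

lemma lookup_fscale [simp]: "Poly_Mapping.lookup (fscale c p) x = c * Poly_Mapping.lookup p x"
  unfolding fscale_def by transfer (simp add: when_def)

global_interpretation free: vector_space "fscale :: 'k::field \<Rightarrow> ('x \<Rightarrow>\<^sub>0 'k) \<Rightarrow> 'x \<Rightarrow>\<^sub>0 'k"
  by unfold_locales (auto intro!: poly_mapping_eqI simp: lookup_add algebra_simps)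

text \<open>The linear extension of a function on the basis.\<close>

definition lin_ext ::
  "('k::field \<Rightarrow> 'v::ab_group_add \<Rightarrow> 'v) \<Rightarrow> ('x \<Rightarrow> 'v) \<Rightarrow> ('x \<Rightarrow>\<^sub>0 'k) \<Rightarrow> 'v"
  where "lin_ext s f p = (\<Sum>x\<in>Poly_Mapping.keys p. s (Poly_Mapping.lookup p x) (f x))"

lemma lin_ext_superset:
  assumes "vector_space s" "finite X" "Poly_Mapping.keys p \<subseteq> X"
  shows "lin_ext s f p = (\<Sum>x\<in>X. s (Poly_Mapping.lookup p x) (f x))"
proof -
  interpret vector_space s by fact
  show ?thesis
    unfolding lin_ext_def using assms(2,3)
    by (intro sum.mono_neutral_left) (auto simp: in_keys_iff)
qed

lemma linear_lin_ext:
  assumes "vector_space s"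
  shows "Vector_Spaces.linear fscale s (lin_ext s f)"
proof -
  interpret vector_space s by fact
  have "lin_ext s f (p + q) = lin_ext s f p + lin_ext s f q" for p q
  proof -
    let ?X = "Poly_Mapping.keys p \<union> Poly_Mapping.keys q"
    have "Poly_Mapping.keys (p + q) \<subseteq> ?X" by (rule keys_add)
    then have "lin_ext s f (p + q) = (\<Sum>x\<in>?X. s (Poly_Mapping.lookup (p + q) x) (f x))"
      by (intro lin_ext_superset assms) auto
    moreover have "lin_ext s f p = (\<Sum>x\<in>?X. s (Poly_Mapping.lookup p x) (f x))"
      by (intro lin_ext_superset assms) auto
    moreover have "lin_ext s f q = (\<Sum>x\<in>?X. s (Poly_Mapping.lookup q x) (f x))"
      by (intro lin_ext_superset assms) auto
    ultimately show ?thesis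
      by (simp add: lookup_add scale_left_distrib sum.distrib)
  qed
  moreover have "lin_ext s f (fscale c p) = s c (lin_ext s f p)" for c p
  proof -
    have "Poly_Mapping.keys (fscale c p) \<subseteq> Poly_Mapping.keys p" by (auto simp: in_keys_iff)
    then have "lin_ext s f (fscale c p) = (\<Sum>x\<in>Poly_Mapping.keys p. s (Poly_Mapping.lookup (fscale c p) x) (f x))"
      by (intro lin_ext_superset assms) auto
    then show ?thesis by (simp add: lin_ext_def scale_sum_right)
  qed
  ultimately show ?thesis
    by unfold_locales (simp_all add: free.scale_left_distrib)
qed

lemma lin_ext_single:
  assumes "vector_space s"
  shows "lin_ext s f (Poly_Mapping.single x 1) = f x"
  using assms by (simp add: lin_ext_def vector_space.vector_space_assms(4))

lemma lin_ext_linear_fun: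
  assumes "vector_space s"
  shows "lin_ext s (\<lambda>x. f x - g x) p = lin_ext s f p - lin_ext s g p"
    and "lin_ext s (\<lambda>x. s c (f x)) p = s c (lin_ext s f p)"
proof -
  interpret vector_space s by fact
  show "lin_ext s (\<lambda>x. f x - g x) p = lin_ext s f p - lin_ext s g p"
    by (simp add: lin_ext_def scale_right_diff_distrib sum_subtractf)
  show "lin_ext s (\<lambda>x. s c (f x)) p = s c (lin_ext s f p)"
    by (simp add: lin_ext_def scale_sum_right mult.commute)
qed

lemma lin_ext_in_subspace:
  assumes "vector_space s" "module.subspace s W" "\<And>x. f x \<in> W"
  shows "lin_ext s f p \<in> W"
proof -
  interpret vector_space s by fact
  show ?thesis
    unfolding lin_ext_def using assms(2,3) by (intro subspace_sum subspace_scale) auto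
qed


section \<open>Algebras and tensor powers\<close>

text \<open>Associative unital algebras over a field, not necessarily commutative.\<close>

locale field_algebra = vector_space scale
  for scale :: "'k::field \<Rightarrow> 'h::ring_1 \<Rightarrow> 'h" +
  assumes scale_mult_left: "scale c x * y = scale c (x * y)"
    and scale_mult_right: "x * scale c y = scale c (x * y)"
begin

definition subalgebra :: "'h set \<Rightarrow> bool"
  where "subalgebra B \<longleftrightarrow> subspace B \<and> 1 \<in> B \<and> (\<forall>x\<in>B. \<forall>y\<in>B. x * y \<in> B)"

definition finite_dimensional :: "'h set \<Rightarrow> bool"
  where "finite_dimensional V \<longleftrightarrow> (\<exists>B. finite B \<and> span B = V)"

text \<open>
  Tensor products of copies of the algebra are constructed as the free vector space on tuples
  modulo the multilinearity relations. A set of \<^emph>\<open>slots\<close> consists of the functions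
  that put an element into one position of a tuple whose other entries are arbitrary but fixed.
  An element of a tensor product is a coset, that is, a set of formal linear combinations.
\<close>

definition multilinear_relations :: "('h \<Rightarrow> 'x) set \<Rightarrow> ('x \<Rightarrow>\<^sub>0 'k) set"
  where "multilinear_relations slots =
    {Poly_Mapping.single (f (x + y)) 1 - Poly_Mapping.single (f x) 1 - Poly_Mapping.single (f y) 1
      | f x y. f \<in> slots} \<union>
    {Poly_Mapping.single (f (scale c x)) 1 - fscale c (Poly_Mapping.single (f x) 1)
      | f c x. f \<in> slots}"

definition tensor_class :: "('h \<Rightarrow> 'x) set \<Rightarrow> ('x \<Rightarrow>\<^sub>0 'k) \<Rightarrow> ('x \<Rightarrow>\<^sub>0 'k) set"
  where "tensor_class slots p = {q. q - p \<in> free.span (multilinear_relations slots)}"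

definition slots2 :: "('h \<Rightarrow> 'h \<times> 'h) set"
  where "slots2 = range (\<lambda>b a. (a, b)) \<union> range (\<lambda>a b. (a, b))"

definition slots3 :: "('h \<Rightarrow> 'h \<times> 'h \<times> 'h) set"
  where "slots3 = range (\<lambda>(b, c) a. (a, b, c)) \<union> range (\<lambda>(a, c) b. (a, b, c))
    \<union> range (\<lambda>(a, b) c. (a, b, c))"

definition tensor2 :: "('h \<times> 'h \<Rightarrow>\<^sub>0 'k) set set"
  where "tensor2 = range (tensor_class slots2)"

text \<open>
  Operations on tensors are induced by operations on arbitrarily chosen representatives.
  The choice does not matter, see the lemmas \<open>tensor_add_class\<close>, \<open>tensor_scale_class\<close>,
  \<open>tensor_mult_class\<close> and \<open>tensor_lift_class\<close> below.
\<close>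

definition rep :: "('x \<Rightarrow>\<^sub>0 'k) set \<Rightarrow> 'x \<Rightarrow>\<^sub>0 'k"
  where "rep t = (SOME p. p \<in> t)"

definition pure :: "'h \<Rightarrow> 'h \<Rightarrow> ('h \<times> 'h \<Rightarrow>\<^sub>0 'k) set"
  where "pure a b = tensor_class slots2 (Poly_Mapping.single (a, b) 1)"

definition tensor_add ::
  "('h \<times> 'h \<Rightarrow>\<^sub>0 'k) set \<Rightarrow> ('h \<times> 'h \<Rightarrow>\<^sub>0 'k) set \<Rightarrow> ('h \<times> 'h \<Rightarrow>\<^sub>0 'k) set"
  where "tensor_add s t = tensor_class slots2 (rep s + rep t)"

definition tensor_scale :: "'k \<Rightarrow> ('h \<times> 'h \<Rightarrow>\<^sub>0 'k) set \<Rightarrow> ('h \<times> 'h \<Rightarrow>\<^sub>0 'k) set"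
  where "tensor_scale c t = tensor_class slots2 (fscale c (rep t))"

definition tensor_mult ::
  "('h \<times> 'h \<Rightarrow>\<^sub>0 'k) set \<Rightarrow> ('h \<times> 'h \<Rightarrow>\<^sub>0 'k) set \<Rightarrow> ('h \<times> 'h \<Rightarrow>\<^sub>0 'k) set"
  where "tensor_mult s t = tensor_class slots2
    (lin_ext fscale (\<lambda>(a, b).
       lin_ext fscale (\<lambda>(c, d). Poly_Mapping.single (a * c, b * d) 1) (rep t)) (rep s))"

text \<open>The linear map on the tensor square induced by a bilinear map \<open>f\<close>.\<close>

definition tensor_lift :: "('h \<Rightarrow> 'h \<Rightarrow> 'h) \<Rightarrow> ('h \<times> 'h \<Rightarrow>\<^sub>0 'k) set \<Rightarrow> 'h"
  where "tensor_lift f t = lin_ext scale (\<lambda>(a, b). f a b) (rep t)"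

text \<open>The image in the tensor square of the tensor product of two subspaces.\<close>

definition tensor_of :: "'h set \<Rightarrow> 'h set \<Rightarrow> ('h \<times> 'h \<Rightarrow>\<^sub>0 'k) set set"
  where "tensor_of A B = tensor_class slots2 ` {p. Poly_Mapping.keys p \<subseteq> A \<times> B}"

lemma tensor_class_self: "p \<in> tensor_class slots p"
  by (simp add: tensor_class_def free.span_zero)

lemma tensor_class_eq_iff:
  "tensor_class slots p = tensor_class slots q
    \<longleftrightarrow> p - q \<in> free.span (multilinear_relations slots)"
proof
  assume "tensor_class slots p = tensor_class slots q"
  then have "p \<in> tensor_class slots q" using tensor_class_self by blast
  then show "p - q \<in> free.span (multilinear_relations slots)" by (simp add: tensor_class_def)
next
  assume *: "p - q \<in> free.span (multilinear_relations slots)"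
  have "r - p \<in> free.span (multilinear_relations slots)
      \<longleftrightarrow> r - q \<in> free.span (multilinear_relations slots)" for r
    using free.span_add[OF _ *, of "r - p"] free.span_diff[OF _ *, of "r - q"] by auto
  then show "tensor_class slots p = tensor_class slots q" by (auto simp: tensor_class_def)
qed

lemma tensor_class_rep:
  "tensor_class slots (rep (tensor_class slots p)) = tensor_class slots p"
proof -
  have "rep (tensor_class slots p) \<in> tensor_class slots p"
    unfolding rep_def by (rule someI, rule tensor_class_self)
  then show ?thesis
    by (subst tensor_class_eq_iff) (simp add: tensor_class_def)
qed

text \<open>
  Universal property: a map that is multilinear modulo a subspace \<open>W\<close> factors through the
  tensor product; \<open>W = {0}\<close> is the usual statement, and for \<open>W\<close> the span of multilinear
  relations the target is again a tensor product.
\<close>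

lemma lin_ext_tensor_class_eq:
  assumes s: "vector_space s" and W: "module.subspace s W"
    and add: "\<And>g x y. g \<in> slots \<Longrightarrow> f (g (x + y)) - f (g x) - f (g y) \<in> W"
    and scale: "\<And>g c x. g \<in> slots \<Longrightarrow> f (g (scale c x)) - s c (f (g x)) \<in> W"
    and eq: "tensor_class slots p = tensor_class slots q"
  shows "lin_ext s f p - lin_ext s f q \<in> W"
proof -
  interpret L: Vector_Spaces.linear fscale s "lin_ext s f" using s by (rule linear_lin_ext)
  have "multilinear_relations slots \<subseteq> {r. lin_ext s f r \<in> W}"
    unfolding multilinear_relations_def
    using add scale by (auto simp: L.diff L.scale lin_ext_single[OF s])
  moreover have "free.subspace {r. lin_ext s f r \<in> W}"
    using W by (auto simp: free.subspace_def L.vs2.subspace_def L.add L.scale L.zero)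
  ultimately have "free.span (multilinear_relations slots) \<subseteq> {r. lin_ext s f r \<in> W}"
    by (rule free.span_minimal)
  with eq show ?thesis by (auto simp: tensor_class_eq_iff L.diff)
qed

lemma tensor_class_diffI:
  "p - q \<in> free.span (multilinear_relations slots) \<Longrightarrow> tensor_class slots p = tensor_class slots q"
  by (simp add: tensor_class_eq_iff)

lemma tensor_class_rep_diff:
  "rep (tensor_class slots p) - p \<in> free.span (multilinear_relations slots)"
  using tensor_class_rep by (simp add: tensor_class_eq_iff)

lemma tensor_add_class:
  "tensor_add (tensor_class slots2 p) (tensor_class slots2 q) = tensor_class slots2 (p + q)"
  unfolding tensor_add_def
  using free.span_add[OF tensor_class_rep_diff[of slots2 p] tensor_class_rep_diff[of slots2 q]]
  by (intro tensor_class_diffI) (simp add: algebra_simps)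

lemma tensor_scale_class:
  "tensor_scale c (tensor_class slots2 p) = tensor_class slots2 (fscale c p)"
  unfolding tensor_scale_def
  using free.span_scale[OF tensor_class_rep_diff[of slots2 p], of c]
  by (intro tensor_class_diffI) (simp add: free.scale_right_diff_distrib)

lemma slots2_cases:
  assumes "g \<in> slots2"
  obtains b where "g = (\<lambda>a. (a, b))" | a where "g = (\<lambda>b. (a, b))"
  using assms by (auto simp: slots2_def)

lemma multilinear_relationsI:
  assumes "g \<in> slots"
  shows "Poly_Mapping.single (g (x + y)) 1 - Poly_Mapping.single (g x) 1
      - Poly_Mapping.single (g y) 1 \<in> multilinear_relations slots"
    and "Poly_Mapping.single (g (scale c x)) 1 - fscale c (Poly_Mapping.single (g x) 1)
      \<in> multilinear_relations slots"
  unfolding multilinear_relations_def using assms by blast+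

lemma slots2I: "(\<lambda>a. (a, b)) \<in> slots2" "(\<lambda>b. (a, b)) \<in> slots2"
  by (auto simp: slots2_def)

lemmas multilinear_relations_slots2 =
  multilinear_relationsI[OF slots2I(1)] multilinear_relationsI[OF slots2I(2)]

lemma tensor_mult_class:
  "tensor_mult (tensor_class slots2 p) (tensor_class slots2 q) = tensor_class slots2
    (lin_ext fscale (\<lambda>(a, b).
       lin_ext fscale (\<lambda>(c, d). Poly_Mapping.single (a * c, b * d) 1) q) p)"
proof -
  let ?W = "free.span (multilinear_relations slots2)"
  define e :: "'h \<times> 'h \<Rightarrow> 'h \<times> 'h \<Rightarrow> ('h \<times> 'h \<Rightarrow>\<^sub>0 'k)"
    where "e = (\<lambda>(a, b) (c, d). Poly_Mapping.single (a * c, b * d) 1)"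
  let ?P = "rep (tensor_class slots2 p)" and ?Q = "rep (tensor_class slots2 q)"
  have v: "vector_space (fscale :: 'k \<Rightarrow> ('h \<times> 'h \<Rightarrow>\<^sub>0 'k) \<Rightarrow> _)"
    by unfold_locales
  have W: "free.subspace ?W" by (rule free.subspace_span)
  have e: "e (g (x + y)) z - e (g x) z - e (g y) z \<in> ?W"
    "e z (g (x + y)) - e z (g x) - e z (g y) \<in> ?W"
    "e (g (scale c x)) z - fscale c (e (g x) z) \<in> ?W"
    "e z (g (scale c x)) - fscale c (e z (g x)) \<in> ?W" if "g \<in> slots2" for g x y z c
    using that
    by (cases z; auto elim!: slots2_cases intro!: free.span_base multilinear_relations_slots2
        simp: e_def distrib_left distrib_right scale_mult_left scale_mult_right)+
  have inner: "lin_ext fscale (e z) ?Q - lin_ext fscale (e z) q \<in> ?W" for z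
    by (rule lin_ext_tensor_class_eq[OF v W _ _ tensor_class_rep]) (auto intro: e)
  have outer: "lin_ext fscale (\<lambda>z. lin_ext fscale (e z) q) ?P
      - lin_ext fscale (\<lambda>z. lin_ext fscale (e z) q) p \<in> ?W"
  proof (rule lin_ext_tensor_class_eq[OF v W _ _ tensor_class_rep])
    fix g :: "'h \<Rightarrow> 'h \<times> 'h" and x y c
    assume g: "g \<in> slots2"
    show "lin_ext fscale (e (g (x + y))) q - lin_ext fscale (e (g x)) q
        - lin_ext fscale (e (g y)) q \<in> ?W"
      unfolding lin_ext_linear_fun(1)[OF v, symmetric]
      by (rule lin_ext_in_subspace[OF v W]) (rule e(1)[OF g])
    show "lin_ext fscale (e (g (scale c x))) q - fscale c (lin_ext fscale (e (g x)) q) \<in> ?W"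
      unfolding lin_ext_linear_fun[OF v, symmetric]
      by (rule lin_ext_in_subspace[OF v W]) (rule e(3)[OF g])
  qed
  have "lin_ext fscale (\<lambda>z. lin_ext fscale (e z) ?Q) ?P
      - lin_ext fscale (\<lambda>z. lin_ext fscale (e z) q) ?P \<in> ?W"
    unfolding lin_ext_linear_fun(1)[OF v, symmetric]
    by (rule lin_ext_in_subspace[OF v W]) (rule inner)
  from free.span_add[OF this outer]
  have "tensor_class slots2 (lin_ext fscale (\<lambda>z. lin_ext fscale (e z) ?Q) ?P)
      = tensor_class slots2 (lin_ext fscale (\<lambda>z. lin_ext fscale (e z) q) p)"
    by (intro tensor_class_diffI) simp
  then show ?thesis
    by (simp add: tensor_mult_def e_def case_prod_unfold)
qed

lemma tensor_lift_class:
  assumes "\<And>b. Vector_Spaces.linear scale scale (\<lambda>a. f a b)"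
    and "\<And>a. Vector_Spaces.linear scale scale (f a)"
  shows "tensor_lift f (tensor_class slots2 p) = lin_ext scale (\<lambda>(a, b). f a b) p"
proof -
  have "tensor_lift f (tensor_class slots2 p) - lin_ext scale (\<lambda>(a, b). f a b) p \<in> {0}"
    unfolding tensor_lift_def
  proof (rule lin_ext_tensor_class_eq[OF _ _ _ _ tensor_class_rep])
    show "vector_space scale" by unfold_locales
    show "subspace {0}" by simp
  next
    fix g :: "'h \<Rightarrow> 'h \<times> 'h" and x y c
    interpret L1: Vector_Spaces.linear scale scale "\<lambda>a. f a b" for b by (rule assms)
    interpret L2: Vector_Spaces.linear scale scale "f a" for a by (rule assms)
    assume "g \<in> slots2"
    then show "(case g (x + y) of (a, b) \<Rightarrow> f a b) - (case g x of (a, b) \<Rightarrow> f a b)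
        - (case g y of (a, b) \<Rightarrow> f a b) \<in> {0}"
      and "(case g (scale c x) of (a, b) \<Rightarrow> f a b)
        - scale c (case g x of (a, b) \<Rightarrow> f a b) \<in> {0}"
      by (auto elim!: slots2_cases simp: L1.add L2.add L1.scale L2.scale)
  qed
  then show ?thesis by simp
qed

end


section \<open>Hopf algebras\<close>

locale hopf_algebra = field_algebra scale
  for scale :: "'k::field \<Rightarrow> 'h::ring_1 \<Rightarrow> 'h" +
  fixes \<Delta> :: "'h \<Rightarrow> ('h \<times> 'h \<Rightarrow>\<^sub>0 'k) set"
    and \<epsilon> :: "'h \<Rightarrow> 'k"
    and S :: "'h \<Rightarrow> 'h"
  assumes comult_in_tensor2: "\<Delta> h \<in> tensor2"
    and comult_add: "\<Delta> (x + y) = tensor_add (\<Delta> x) (\<Delta> y)"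
    and comult_scale: "\<Delta> (scale c x) = tensor_scale c (\<Delta> x)"
    and comult_one: "\<Delta> 1 = pure 1 1"
    and comult_mult: "\<Delta> (x * y) = tensor_mult (\<Delta> x) (\<Delta> y)"
    and counit_linear: "Vector_Spaces.linear scale (*) \<epsilon>"
    and counit_one: "\<epsilon> 1 = 1"
    and counit_mult: "\<epsilon> (x * y) = \<epsilon> x * \<epsilon> y"
    and coassoc: \<comment> \<open>\<open>(\<Delta> \<otimes> id) \<circ> \<Delta> = (id \<otimes> \<Delta>) \<circ> \<Delta>\<close>\<close>
      "tensor_class slots3 (lin_ext fscale (\<lambda>(a, b).
          lin_ext fscale (\<lambda>(x, y). Poly_Mapping.single (x, y, b) 1) (rep (\<Delta> a))) (rep (\<Delta> h)))
        = tensor_class slots3 (lin_ext fscale (\<lambda>(a, b).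
          lin_ext fscale (\<lambda>(x, y). Poly_Mapping.single (a, x, y) 1) (rep (\<Delta> b))) (rep (\<Delta> h)))"
    and counit_left: "tensor_lift (\<lambda>a b. scale (\<epsilon> a) b) (\<Delta> h) = h"
    and counit_right: "tensor_lift (\<lambda>a b. scale (\<epsilon> b) a) (\<Delta> h) = h"
    and antipode_linear: "Vector_Spaces.linear scale scale S"
    and antipode_left: "tensor_lift (\<lambda>a b. S a * b) (\<Delta> h) = scale (\<epsilon> h) 1"
    and antipode_right: "tensor_lift (\<lambda>a b. a * S b) (\<Delta> h) = scale (\<epsilon> h) 1"
begin

definition adjoint_action :: "'h \<Rightarrow> 'h \<Rightarrow> 'h"
  where "adjoint_action k h = tensor_lift (\<lambda>a b. a * h * S b) (\<Delta> k)"

definition adjoint_stable :: "'h set \<Rightarrow> bool"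
  where "adjoint_stable V \<longleftrightarrow> (\<forall>k. \<forall>v\<in>V. adjoint_action k v \<in> V)"

definition left_coideal_subalgebra :: "'h set \<Rightarrow> bool"
  where "left_coideal_subalgebra B \<longleftrightarrow> subalgebra B \<and> \<Delta> ` B \<subseteq> tensor_of UNIV B"

end

end

theory Submission
  imports Defs
begin

text \<open>
  The identity \<open>(x\<^sub>1 . h) x\<^sub>2 = x\<^sub>1 h S(x\<^sub>2) x\<^sub>3 = x h\<close> (Sweedler notation) shows that \<open>C\<^sub>i C \<subseteq> C C\<^sub>i\<close>
  for the left coideal subalgebra \<open>C\<^sub>i\<close> and the adjoint stable subspace \<open>C\<close>. In a product of
  \<open>k + 1\<close> factors, each taken from one of \<open>C\<^sub>1, \<dots>, C\<^sub>k\<close>, some \<open>C\<^sub>i\<close>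
  occurs twice; moving its first occurrence to the right until it meets the second one and using
  \<open>C\<^sub>i C\<^sub>i \<subseteq> C\<^sub>i\<close> shortens the product. Hence the \<open>(k + 1)\<close>-st power of \<open>C\<close> is
  contained in the \<open>k\<close>-th one, which is therefore the subalgebra generated by \<open>C\<close>.
\<close>

section \<open>Elementwise products of sets and sums of subspaces\<close>

lemma finite_set_power: "finite B \<Longrightarrow> finite (B ^ n)" for B :: "'a::monoid_mult set"
  by (induction n) (simp_all add: finite_set_times set_one)

lemma set_power_mono: "A ^ n \<subseteq> B ^ n" if "A \<subseteq> B" for A B :: "'a::monoid_mult set"
  using that by (induction n) (simp_all add: set_times_mono2)

lemma prod_list_in_set_power:
  fixes A :: "'a::monoid_mult set"
  shows "set xs \<subseteq> A \<Longrightarrow> prod_list xs \<in> A ^ length xs"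
  by (induction xs) (auto simp: set_one intro: set_times_intro)

lemma set_power_eq_prod_list:
  fixes A :: "'a::monoid_mult set"
  shows "A ^ n = prod_list ` {xs. set xs \<subseteq> A \<and> length xs = n}"
proof
  show "A ^ n \<subseteq> prod_list ` {xs. set xs \<subseteq> A \<and> length xs = n}"
  proof (induction n)
    case 0
    then show ?case by (auto simp: set_one)
  next
    case (Suc n)
    show ?case
    proof
      fix z assume "z \<in> A ^ Suc n"
      then obtain x y where "x \<in> A" "y \<in> A ^ n" "z = x * y" by (auto elim: set_times_elim)
      with Suc obtain xs where "set xs \<subseteq> A" "length xs = n" "y = prod_list xs" by blast
      with \<open>x \<in> A\<close> \<open>z = x * y\<close>
      show "z \<in> prod_list ` {xs. set xs \<subseteq> A \<and> length xs = Suc n}"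
        by (intro image_eqI[of _ _ "x # xs"]) auto
    qed
  qed
qed (auto intro: prod_list_in_set_power)


context module
begin

text \<open>Replaces the elementwise sum of sets by a span, so that powers of the sum are controlled
  by words with letters in the single summands.\<close>

lemma sum_subspaces_eq_span_UN:
  assumes "finite I" "\<And>i. i \<in> I \<Longrightarrow> subspace (D i)"
  shows "(\<Sum>i\<in>I. D i) = span (\<Union>i\<in>I. D i)"
  using assms
proof (induction I)
  case empty
  then show ?case by (simp add: set_zero)
next
  case (insert i I)
  have "span (\<Union>j\<in>insert i I. D j) = {x + y |x y. x \<in> span (D i) \<and> y \<in> span (\<Union>j\<in>I. D j)}"
    by (simp add: span_Un)
  moreover have "span (D i) = D i" using insert.prems by (simp add: span_eq_iff)
  moreover have "(\<Sum>j\<in>I. D j) = span (\<Union>j\<in>I. D j)" using insert by simp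
  ultimately show ?case using insert.hyps by (auto simp: set_plus_def)
qed

end


section \<open>Spans of products and generated subalgebras\<close>

context field_algebra
begin

text \<open>The elementwise product of two subspaces need not be a subspace; therefore all
  inclusions between products below end in an explicit \<open>span\<close>.\<close>

lemma span_mult_span_subset: "span A * span B \<subseteq> span (A * B)"
proof -
  have *: "x * b \<in> span (A * B)" if "x \<in> span A" "b \<in> B" for x b
    using that(1)
    by (induction rule: span_induct_alt)
      (auto simp: distrib_right scale_mult_left span_zero
        intro!: span_add[OF span_scale[OF span_base]] set_times_intro that)
  have "x * y \<in> span (A * B)" if "x \<in> span A" "y \<in> span B" for x y
    using that(2)
    by (induction rule: span_induct_alt)
      (simp_all add: distrib_left scale_mult_right span_zero span_add span_scale * that(1))
  then show ?thesis by (auto elim!: set_times_elim)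
qed

lemma span_mult_subsetI:
  assumes "A \<subseteq> span A'" "B \<subseteq> span B'"
  shows "A * B \<subseteq> span (A' * B')"
  using set_times_mono2[OF assms] span_mult_span_subset by blast

lemma span_power_subset: "span A ^ n \<subseteq> span (A ^ n)"
proof (induction n)
  case 0
  then show ?case by (simp add: span_superset)
next
  case (Suc n)
  then show ?case by (simp add: span_mult_subsetI)
qed

lemma span_power_span: "span (span A ^ n) = span (A ^ n)"
  by (intro subset_antisym span_minimal span_power_subset span_mono set_power_mono span_superset subspace_span)

lemma finite_dimensional_span_power:
  assumes "finite_dimensional V"
  shows "finite_dimensional (span (V ^ n))"
  using assms unfolding finite_dimensional_def by (metis finite_set_power span_power_span)

lemma finite_dimensional_span_UN:
  assumes "finite I" "\<And>i. i \<in> I \<Longrightarrow> finite_dimensional (D i)"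
  shows "finite_dimensional (span (\<Union>i\<in>I. D i))"
proof -
  obtain B where B: "\<And>i. i \<in> I \<Longrightarrow> finite (B i) \<and> span (B i) = D i"
    using assms(2) unfolding finite_dimensional_def by metis
  have "span (\<Union>i\<in>I. B i) = span (\<Union>i\<in>I. D i)"
  proof (rule subset_antisym)
    show "span (\<Union>i\<in>I. B i) \<subseteq> span (\<Union>i\<in>I. D i)"
      using B by (intro span_mono) (blast intro: span_base)
    have "D i \<subseteq> span (\<Union>i\<in>I. B i)" if "i \<in> I" for i
      using B[OF that] span_mono[of "B i" "\<Union>i\<in>I. B i"] that by blast
    then show "span (\<Union>i\<in>I. D i) \<subseteq> span (\<Union>i\<in>I. B i)"
      by (intro span_minimal) auto
  qed
  with assms(1) B show ?thesis unfolding finite_dimensional_def by (metis finite_UN)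
qed

lemma subalgebra_hull: "subalgebra (subalgebra hull X)"
  unfolding hull_def subalgebra_def by (auto intro: subspace_Inter)

lemma span_power_subset_subalgebra:
  assumes "subalgebra A" "V \<subseteq> A"
  shows "span (V ^ n) \<subseteq> A"
proof -
  have "V ^ n \<subseteq> A"
    using assms by (induction n) (auto simp: subalgebra_def set_one elim!: set_times_elim)
  with assms(1) show ?thesis by (simp add: subalgebra_def span_minimal)
qed

text \<open>\<open>D\<close> moves past one factor \<open>V\<close> at a time.\<close>

lemma mult_power_commute:
  assumes "D * V \<subseteq> span (V * D)"
  shows "D * V ^ n \<subseteq> span (V ^ n * D)"
proof (induction n)
  case 0
  then show ?case by (simp add: span_superset del: set_one)
next
  case (Suc n)
  have "D * V ^ Suc n = (D * V) * V ^ n" by (simp add: mult.assoc)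
  also have "\<dots> \<subseteq> span (V * (D * V ^ n))"
    using span_mult_subsetI[OF assms span_superset, of "V ^ n"] by (simp add: mult.assoc)
  also have "\<dots> \<subseteq> span (V ^ Suc n * D)"
    using span_mult_subsetI[OF span_superset[of V] Suc.IH]
    by (intro span_minimal) (simp_all add: mult.assoc)
  finally show ?case .
qed

text \<open>The first \<open>D\<close> moves across \<open>V ^ b\<close> to meet the second; the two
  merge into one \<open>D\<close>, which counts as a single factor \<open>V\<close>. Of
  \<open>a + b + 2 + c\<close> factors one is lost.\<close>

lemma word_with_repetition_shortens:
  assumes "D * V \<subseteq> span (V * D)" "D * D \<subseteq> D" "D \<subseteq> V"
  shows "V ^ a * (D * (V ^ b * (D * V ^ c))) \<subseteq> span (V ^ (a + b + 1 + c))"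
proof -
  have "D * V ^ b * D \<subseteq> span (V ^ b * D * D)"
    using mult_power_commute[OF assms(1)] span_superset by (rule span_mult_subsetI)
  also have "\<dots> \<subseteq> span (V ^ b * V)"
    using assms(2,3) by (intro span_mono) (simp add: mult.assoc set_times_mono2)
  finally have "D * V ^ b * D * V ^ c \<subseteq> span (V ^ b * V * V ^ c)"
    by (rule span_mult_subsetI) (rule span_superset)
  from span_mult_subsetI[OF span_superset[of "V ^ a"] this]
  show ?thesis by (simp only: mult.assoc power_add power_one_right)
qed

lemma power_Suc_card_subset:
  assumes I: "finite I"
    and comm: "\<And>i. i \<in> I \<Longrightarrow> D i * V \<subseteq> span (V * D i)"
    and closed: "\<And>i. i \<in> I \<Longrightarrow> D i * D i \<subseteq> D i"
    and V: "V = span (\<Union>i\<in>I. D i)"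
  shows "V ^ Suc (card I) \<subseteq> span (V ^ card I)"
proof -
  let ?G = "\<Union>i\<in>I. D i"
  \<comment> \<open>Products of letters from the union suffice, since they span all products of
    elements of \<open>V\<close>.\<close>
  have "?G ^ Suc (card I) \<subseteq> span (V ^ card I)"
    unfolding set_power_eq_prod_list[of ?G]
  proof clarify
    fix xs assume xs: "set xs \<subseteq> ?G" "length xs = Suc (card I)"
    \<comment> \<open>A letter may lie in several \<open>D i\<close>, so one index is chosen for
      each; by the pigeonhole principle some index then repeats in \<open>xs\<close>.\<close>
    define f where "f x = (SOME i. i \<in> I \<and> x \<in> D i)" for x
    have f: "f x \<in> I \<and> x \<in> D (f x)" if "x \<in> set xs" for x
      using xs(1) that someI_ex[of "\<lambda>i. i \<in> I \<and> x \<in> D i"] by (auto simp: f_def)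
    have "\<not> distinct (map f xs)"
    proof
      assume "distinct (map f xs)"
      then have "card (f ` set xs) = Suc (card I)" using xs(2) distinct_card by fastforce
      moreover have "card (f ` set xs) \<le> card I" using f I by (intro card_mono) auto
      ultimately show False by simp
    qed
    then obtain us i vs ws where "map f xs = us @ [i] @ vs @ [i] @ ws"
      using not_distinct_decomp by blast
    then obtain us' x vs' y ws' where eq: "xs = us' @ [x] @ vs' @ [y] @ ws'"
        and "f x = i" "f y = i"
      by (auto simp: map_eq_append_conv map_eq_Cons_conv append_eq_map_conv Cons_eq_map_conv)
    then have i: "i \<in> I" "x \<in> D i" "y \<in> D i" using f[of x] f[of y] by auto
    \<comment> \<open>Only the two letters with the repeated index need to be located in
      \<open>D i\<close>; for all others membership in \<open>V\<close> is enough.\<close>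
    have "set xs \<subseteq> V" using xs(1) V span_superset by auto
    then have "prod_list xs \<in> V ^ length us' * (D i * (V ^ length vs' * (D i * V ^ length ws')))"
      using i by (simp add: eq set_times_intro prod_list_in_set_power)
    moreover have "D i \<subseteq> V" unfolding V using i(1) by (blast intro: span_base)
    ultimately have "prod_list xs \<in> span (V ^ (length us' + length vs' + 1 + length ws'))"
      using word_with_repetition_shortens[OF comm[OF i(1)] closed[OF i(1)]] by blast
    moreover have "length us' + length vs' + 1 + length ws' = card I" using xs(2) eq by simp
    ultimately show "prod_list xs \<in> span (V ^ card I)" by metis
  qed
  then have "span (?G ^ Suc (card I)) \<subseteq> span (V ^ card I)" by (simp add: span_minimal)
  then show ?thesis using span_power_subset[of ?G "Suc (card I)"] unfolding V by blast
qed

text \<open>Iterating \<open>stab\<close> absorbs any number of additional factors \<open>V\<close>;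
  absorbing \<open>n\<close> of them gives closure under multiplication.\<close>

lemma subalgebra_span_power:
  assumes "1 \<in> V ^ n" and stab: "V ^ Suc n \<subseteq> span (V ^ n)"
  shows "subalgebra (span (V ^ n))"
proof -
  have *: "V ^ (m + n) \<subseteq> span (V ^ n)" for m
  proof (induction m)
    case 0
    then show ?case by (simp add: span_superset)
  next
    case (Suc m)
    have "V ^ (Suc m + n) \<subseteq> span (V * V ^ n)"
      using span_mult_subsetI[OF span_superset Suc.IH, of V] by simp
    also have "\<dots> \<subseteq> span (V ^ n)" using stab by (intro span_minimal) simp_all
    finally show ?case .
  qed
  have "span (V ^ n) * span (V ^ n) \<subseteq> span (V ^ (n + n))"
    using span_mult_span_subset[of "V ^ n" "V ^ n"] by (simp add: power_add)
  also have "\<dots> \<subseteq> span (V ^ n)" by (intro span_minimal * subspace_span)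
  finally show ?thesis
    using assms(1) by (auto simp: subalgebra_def span_base intro: set_times_intro)
qed

lemma finite_dimensional_subalgebra_hull:
  assumes I: "finite I"
    and sub: "\<And>i. i \<in> I \<Longrightarrow> subalgebra (D i)"
    and fin: "\<And>i. i \<in> I \<Longrightarrow> finite_dimensional (D i)"
    and comm: "\<And>i. i \<in> I \<Longrightarrow> D i * (\<Sum>j\<in>I. D j) \<subseteq> span ((\<Sum>j\<in>I. D j) * D i)"
  shows "finite_dimensional (subalgebra hull (\<Sum>i\<in>I. D i))"
proof -
  define V where "V = (\<Sum>i\<in>I. D i)"
  have V: "V = span (\<Union>i\<in>I. D i)"
    unfolding V_def using I sub by (intro sum_subspaces_eq_span_UN) (auto simp: subalgebra_def)
  \<comment> \<open>An empty \<open>I\<close> gives \<open>V = {0}\<close>, which contains 1 only if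
    \<open>1 = 0\<close>; this case is treated separately below.\<close>
  have one: "1 \<in> V ^ n" if "I \<noteq> {}" for n
  proof -
    from that obtain i where "i \<in> I" by blast
    then have "1 \<in> (\<Union>i\<in>I. D i)" using sub by (auto simp: subalgebra_def)
    then have "1 \<in> V" unfolding V by (rule span_base)
    then show ?thesis by (induction n) (auto intro: set_times_intro[of 1 V 1, simplified])
  qed
  have "V ^ Suc (card I) \<subseteq> span (V ^ card I)"
    using I comm sub V unfolding V_def[symmetric]
    by (intro power_Suc_card_subset) (auto simp: subalgebra_def elim!: set_times_elim)
  \<comment> \<open>For empty \<open>I\<close> the exponent is 0 and
    \<open>V ^ 0 = {1}\<close>.\<close>
  moreover have "1 \<in> V ^ card I"
    using one I by (cases "I = {}") (auto simp: set_one)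
  ultimately have alg: "subalgebra (span (V ^ card I))" by (intro subalgebra_span_power)
  have "V \<subseteq> span (V ^ card I)"
  proof (cases "I = {}")
    case True
    then show ?thesis by (auto simp: V span_zero)
  next
    case False
    then obtain n where n: "card I = Suc n" using I by (cases "card I") auto
    \<comment> \<open>An element of \<open>V\<close> is padded with \<open>n\<close> factors
      1.\<close>
    have "V \<subseteq> V ^ card I"
      using set_times_intro[OF _ one[OF False, of n], of _ V] unfolding n by auto
    then show ?thesis using span_superset by blast
  qed
  then have "subalgebra hull V = span (V ^ card I)"
    using alg by (intro subset_antisym hull_minimal span_power_subset_subalgebra subalgebra_hull hull_subset)
  moreover have "finite_dimensional V" unfolding V using I fin by (rule finite_dimensional_span_UN)
  ultimately show ?thesis by (simp add: V_def finite_dimensional_span_power)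
qed

end


section \<open>Comultiplication and the adjoint action\<close>

lemma lin_ext_lin_ext:
  assumes "vector_space s"
  shows "lin_ext s f (lin_ext fscale g p) = lin_ext s (\<lambda>x. lin_ext s f (g x)) p"
proof -
  interpret L: Vector_Spaces.linear fscale s "lin_ext s f" using assms by (rule linear_lin_ext)
  show ?thesis by (simp add: lin_ext_def[of fscale] lin_ext_def[of s _ p] L.sum L.scale)
qed


context hopf_algebra
begin

lemma vector_space_scale: "vector_space scale"
  by unfold_locales

lemma comult_rep: "tensor_class slots2 (rep (\<Delta> h)) = \<Delta> h"
proof -
  obtain p where "\<Delta> h = tensor_class slots2 p"
    using comult_in_tensor2[of h] unfolding tensor2_def by blast
  then show ?thesis by (simp only: tensor_class_rep)
qed

lemma linear_tensor_lift_comult: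
  assumes "\<And>b. Vector_Spaces.linear scale scale (\<lambda>a. f a b)"
    and "\<And>a. Vector_Spaces.linear scale scale (f a)"
  shows "Vector_Spaces.linear scale scale (\<lambda>h. tensor_lift f (\<Delta> h))"
proof -
  let ?L = "lin_ext scale (\<lambda>(a, b). f a b)"
  interpret L: Vector_Spaces.linear fscale scale ?L
    using vector_space_scale by (rule linear_lin_ext)
  note lift = tensor_lift_class[of f, OF assms]
  have lift_rep: "tensor_lift f (\<Delta> h) = ?L (rep (\<Delta> h))" for h
    using lift[of "rep (\<Delta> h)"] by (simp add: comult_rep)
  have "tensor_lift f (\<Delta> (x + y)) = tensor_lift f (\<Delta> x) + tensor_lift f (\<Delta> y)" for x y
    using lift[of "rep (\<Delta> x) + rep (\<Delta> y)"]
    by (simp add: comult_add tensor_add_def lift_rep L.add)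
  moreover have "tensor_lift f (\<Delta> (scale c x)) = scale c (tensor_lift f (\<Delta> x))" for c x
    using lift[of "fscale c (rep (\<Delta> x))"]
    by (simp add: comult_scale tensor_scale_def lift_rep L.scale)
  ultimately show ?thesis by unfold_locales auto
qed

sublocale antipode: Vector_Spaces.linear scale scale S
  by (rule antipode_linear)

text \<open>Makes \<open>adjoint_action a h * b\<close> bilinear in \<open>a\<close> and
  \<open>b\<close>, so that its lift may be computed on any representative of a tensor.\<close>

lemma linear_adjoint_action: "Vector_Spaces.linear scale scale (\<lambda>x. adjoint_action x h)"
  unfolding adjoint_action_def
  by (rule linear_tensor_lift_comult; unfold_locales)
    (simp_all add: distrib_left distrib_right antipode.add antipode.scale
      scale_mult_left scale_mult_right)

text \<open>The trilinear map \<open>T\<close> is applied to both sides of \<open>coassoc\<close>.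
  Grouping the first two tensor factors yields the adjoint action; grouping the last two lets the
  antipode cancel.\<close>

lemma mult_eq_lift_adjoint_action:
  "x * h = tensor_lift (\<lambda>a b. adjoint_action a h * b) (\<Delta> x)"
proof -
  define T where "T = (\<lambda>(a, b, c). a * h * S b * c)"
  have lin_T: "lin_ext scale T (Poly_Mapping.single z 1) = T z" for z
    by (rule lin_ext_single[OF vector_space_scale])
  let ?l = "lin_ext fscale (\<lambda>(a, b).
    lin_ext fscale (\<lambda>(y, z). Poly_Mapping.single (y, z, b) 1) (rep (\<Delta> a))) (rep (\<Delta> x))"
  let ?r = "lin_ext fscale (\<lambda>(a, b).
    lin_ext fscale (\<lambda>(y, z). Poly_Mapping.single (a, y, z) 1) (rep (\<Delta> b))) (rep (\<Delta> x))"
  \<comment> \<open>Universal property of the triple tensor product, with the zero subspace as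
    \<open>W\<close>.\<close>
  have "lin_ext scale T ?l - lin_ext scale T ?r \<in> {0}"
    by (rule lin_ext_tensor_class_eq[OF vector_space_scale _ _ _ coassoc])
      (auto simp: T_def slots3_def distrib_left distrib_right antipode.add antipode.scale
        scale_mult_left scale_mult_right)
  moreover have "lin_ext scale T ?l = tensor_lift (\<lambda>a b. adjoint_action a h * b) (\<Delta> x)"
    by (simp add: lin_ext_lin_ext[OF vector_space_scale] lin_T case_prod_unfold T_def
        tensor_lift_def adjoint_action_def)
      (simp add: lin_ext_def sum_distrib_right scale_mult_left)
  moreover have "lin_ext scale T ?r = x * h"
  proof -
    \<comment> \<open>The inner sum is \<open>a * h\<close> times the antipode axiom for
      \<open>b\<close>; the remaining scalar \<open>\<epsilon> b\<close> is moved to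
      \<open>a\<close>, ready for \<open>counit_right\<close>.\<close>
    have "lin_ext scale (\<lambda>(y, z). T (a, y, z)) (rep (\<Delta> b)) = scale (\<epsilon> b) a * h" for a b
    proof -
      have "lin_ext scale (\<lambda>(y, z). T (a, y, z)) (rep (\<Delta> b))
          = a * h * tensor_lift (\<lambda>y z. S y * z) (\<Delta> b)"
        by (simp add: T_def tensor_lift_def lin_ext_def sum_distrib_left scale_mult_right
            case_prod_unfold mult.assoc)
      then show ?thesis by (simp add: antipode_left scale_mult_left scale_mult_right)
    qed
    then have "lin_ext scale T ?r = tensor_lift (\<lambda>a b. scale (\<epsilon> b) a) (\<Delta> x) * h"
      by (simp add: lin_ext_lin_ext[OF vector_space_scale] lin_T case_prod_unfold tensor_lift_def)
        (simp add: lin_ext_def sum_distrib_right scale_mult_left)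
    then show ?thesis by (simp add: counit_right)
  qed
  ultimately show ?thesis by simp
qed

lemma coideal_mult_adjoint_stable:
  assumes "\<Delta> ` B \<subseteq> tensor_of UNIV B" "adjoint_stable V"
  shows "B * V \<subseteq> span (V * B)"
proof
  fix z assume "z \<in> B * V"
  then obtain x h where z: "z = x * h" and x: "x \<in> B" and h: "h \<in> V" by (auto elim: set_times_elim)
  have "\<Delta> x \<in> tensor_of UNIV B" using assms(1) x by blast
  \<comment> \<open>The representative \<open>rep (\<Delta> x)\<close> need not have its second
    entries in \<open>B\<close>; the coideal condition supplies a \<open>p\<close> that
    does.\<close>
  then obtain p where p: "\<Delta> x = tensor_class slots2 p" "Poly_Mapping.keys p \<subseteq> UNIV \<times> B"
    unfolding tensor_of_def by blast
  interpret A: Vector_Spaces.linear scale scale "\<lambda>x. adjoint_action x h"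
    by (rule linear_adjoint_action)
  have "z = lin_ext scale (\<lambda>(a, b). adjoint_action a h * b) p"
    unfolding z mult_eq_lift_adjoint_action[of x h] p(1)
    by (rule tensor_lift_class; unfold_locales)
      (simp_all add: distrib_left distrib_right A.add A.scale scale_mult_left scale_mult_right)
  also have "\<dots> \<in> span (V * B)"
    unfolding lin_ext_def
  proof (intro span_sum span_scale span_base)
    fix ab assume "ab \<in> Poly_Mapping.keys p"
    with p(2) have "snd ab \<in> B" by auto
    moreover have "adjoint_action (fst ab) h \<in> V"
      using assms(2) h unfolding adjoint_stable_def by blast
    ultimately show "(case ab of (a, b) \<Rightarrow> adjoint_action a h * b) \<in> V * B"
      by (simp add: case_prod_unfold set_times_intro)
  qed
  finally show "z \<in> span (V * B)" .
qed

end

theorem proposition3: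
  fixes scale :: "'k::field \<Rightarrow> 'h::ring_1 \<Rightarrow> 'h"
    and \<Delta> :: "'h \<Rightarrow> ('h \<times> 'h \<Rightarrow>\<^sub>0 'k) set"
    and \<epsilon> :: "'h \<Rightarrow> 'k"
    and S :: "'h \<Rightarrow> 'h"
    and C :: "nat \<Rightarrow> 'h set"
    and k :: nat
  assumes "hopf_algebra scale \<Delta> \<epsilon> S"
    and "\<And>i. i \<in> {1..k} \<Longrightarrow> hopf_algebra.left_coideal_subalgebra scale \<Delta> (C i)"
    and "\<And>i. i \<in> {1..k} \<Longrightarrow> field_algebra.finite_dimensional scale (C i)"
    and "hopf_algebra.adjoint_stable scale \<Delta> S (\<Sum>i\<in>{1..k}. C i)"
  shows "field_algebra.finite_dimensional scale
    (field_algebra.subalgebra scale hull (\<Sum>i\<in>{1..k}. C i))"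
proof -
  interpret hopf_algebra scale \<Delta> \<epsilon> S by fact
  show ?thesis
    using assms(2-4)
    by (intro finite_dimensional_subalgebra_hull coideal_mult_adjoint_stable)
      (auto simp: left_coideal_subalgebra_def)
qed

end
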